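(* Let $(V,b,m)$ be an infinite, locally finite, connected graph over a non-Archimedean ordered field $\mathbb K$ which is Cauchy complete and has countable cofinality. (a) If there exists a positive superharmonic function on $V$ which is not harmonic, then the graph does not have null capacity. (b) If the field $\mathbb K$ is real closed, then existence of a non-constant positive superharmonic function implies that the graph does not have null capacity.
   Context: An ordered field $(\mathbb K,\succ)$ is non-Archimedean if there is $\tau\succ0$ with $\tau\prec 1/n$ for all $n\in\mathbb N$. $\mathbb K^+=\{k\in\mathbb K: k\succ0\}$. A sequence $(k_n)$ converges to $k\in\mathbb K$ if for every $c\in\mathbb K^+$ one has $|k_n-k|\preceq c$ for all large $n$. Cauchy complete: every Cauchy sequence converges. Countable cofinality: there is a countable $S\subset\mathbb K$ such that every $k\in\mathbb K$ satisfies $k\preceq s$ for some $s\in S$. $\mathbb K$ is real closed if every positive element has a square root and every polynomial of odd degree over $\mathbb K$ has a root in $\mathbb K$. A graph $(V,b,m)$ over $\mathbb K$: $V$ is an at most countable set, $m:V\to\mathbb K^+$, and $b:V\times V\to\mathbb K^+\cup\{0\}$ is symmetric with $b(x,x)=0$. Write $x\sim y$ if $b(x,y)\neq0$; locally finite means each vertex has finitely many neighbors; connectedness is with respect to paths $x_0\sim x_1\sim\dots\sim x_n$, and $d$ is the combinatorial graph distance. $B_n(a)=\{x\in V: d(a,x)<n\}$. Laplacian: $\Delta f(x)=\frac1{m(x)}\sum_{y\in V}(f(x)-f(y))b(x,y)$ for $f:V\to\mathbb K$. A function $u:V\to\mathbb K$ is superharmonic if $\Delta u\succeq0$ on $V$,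 harmonic if $\Delta u=0$ on $V$, and positive if it takes values in $\mathbb K^+\cup\{0\}$. For a finite connected $K\subseteq V$ and $a\in K$ there is a unique $v:V\to\mathbb K$ with $\Delta v=0$ on $K\setminus\{a\}$, $v(a)=1$, $v=0$ on $V\setminus K$; put $\mathrm{cap}_K(a)=\Delta v(a)m(a)$ and $\mathrm{cap}_n(a)=\mathrm{cap}_{B_n(a)}(a)$, $n\ge1$. The graph has null capacity if $\lim_{n\to\infty}\mathrm{cap}_n(a)=0$ for some (equivalently, all) $a\in V$. *)

theory Defs
  imports Main "HOL-Library.Countable_Set" "HOL-Computational_Algebra.Polynomial"
begin

section \<open>Ordered fields\<close>

definition non_archimedean :: "'k::linordered_field itself \<Rightarrow> bool" where
  "non_archimedean _ \<longleftrightarrow> (\<exists>\<tau>::'k. \<tau> > 0 \<and> (\<forall>n::nat. n \<ge> 1 \<longrightarrow> \<tau> < 1 / of_nat n))"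

text \<open>Limits are taken with respect to the order of the field, so the bound \<open>c\<close> ranges over
  all positive elements of the field, infinitesimal ones included.\<close>

definition field_converges :: "(nat \<Rightarrow> 'k::linordered_field) \<Rightarrow> 'k \<Rightarrow> bool" where
  "field_converges k l \<longleftrightarrow> (\<forall>c>0. \<exists>N. \<forall>n\<ge>N. \<bar>k n - l\<bar> \<le> c)"

definition field_Cauchy :: "(nat \<Rightarrow> 'k::linordered_field) \<Rightarrow> bool" where
  "field_Cauchy k \<longleftrightarrow> (\<forall>c>0. \<exists>N. \<forall>i\<ge>N. \<forall>j\<ge>N. \<bar>k i - k j\<bar> \<le> c)"

definition Cauchy_complete :: "'k::linordered_field itself \<Rightarrow> bool" where
  "Cauchy_complete _ \<longleftrightarrow> (\<forall>k::nat \<Rightarrow> 'k. field_Cauchy k \<longrightarrow> (\<exists>l. field_converges k l))"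

definition countable_cofinality :: "'k::linordered_field itself \<Rightarrow> bool" where
  "countable_cofinality _ \<longleftrightarrow> (\<exists>S::'k set. countable S \<and> (\<forall>k. \<exists>s\<in>S. k \<le> s))"

definition real_closed :: "'k::linordered_field itself \<Rightarrow> bool" where
  "real_closed _ \<longleftrightarrow>
     (\<forall>k::'k. k > 0 \<longrightarrow> (\<exists>r. r\<^sup>2 = k)) \<and>
     (\<forall>p::'k poly. odd (degree p) \<longrightarrow> (\<exists>r. poly p r = 0))"

section \<open>Weighted graphs\<close>

text \<open>The vertex set is a carrier \<open>V\<close>. Functions on \<open>V\<close> are total functions on the
  underlying type, and only their values on \<open>V\<close> matter.\<close>

definition weighted_graph ::
  "'v set \<Rightarrow> ('v \<Rightarrow> 'v \<Rightarrow> 'k::linordered_field) \<Rightarrow> ('v \<Rightarrow> 'k) \<Rightarrow> bool" where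
  "weighted_graph V b m \<longleftrightarrow>
     countable V \<and>
     (\<forall>x\<in>V. m x > 0) \<and>
     (\<forall>x\<in>V. \<forall>y\<in>V. b x y \<ge> 0) \<and>
     (\<forall>x\<in>V. \<forall>y\<in>V. b x y = b y x) \<and>
     (\<forall>x\<in>V. b x x = 0)"

definition neighbours :: "'v set \<Rightarrow> ('v \<Rightarrow> 'v \<Rightarrow> 'k::linordered_field) \<Rightarrow> 'v \<Rightarrow> 'v set" where
  "neighbours V b x = {y \<in> V. b x y \<noteq> 0}"

definition edge_rel :: "'v set \<Rightarrow> ('v \<Rightarrow> 'v \<Rightarrow> 'k::linordered_field) \<Rightarrow> ('v \<times> 'v) set" where
  "edge_rel V b = {(x, y). x \<in> V \<and> y \<in> neighbours V b x}"

definition graph_locally_finite :: "'v set \<Rightarrow> ('v \<Rightarrow> 'v \<Rightarrow> 'k::linordered_field) \<Rightarrow> bool" where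
  "graph_locally_finite V b \<longleftrightarrow> (\<forall>x\<in>V. finite (neighbours V b x))"

definition graph_connected :: "'v set \<Rightarrow> ('v \<Rightarrow> 'v \<Rightarrow> 'k::linordered_field) \<Rightarrow> bool" where
  "graph_connected V b \<longleftrightarrow> (\<forall>x\<in>V. \<forall>y\<in>V. (x, y) \<in> (edge_rel V b)\<^sup>*)"

text \<open>The length of a shortest path; an unspecified number if there is no path.\<close>

definition graph_dist :: "'v set \<Rightarrow> ('v \<Rightarrow> 'v \<Rightarrow> 'k::linordered_field) \<Rightarrow> 'v \<Rightarrow> 'v \<Rightarrow> nat" where
  "graph_dist V b x y = (LEAST n. (x, y) \<in> edge_rel V b ^^ n)"

definition graph_ball ::
  "'v set \<Rightarrow> ('v \<Rightarrow> 'v \<Rightarrow> 'k::linordered_field) \<Rightarrow> 'v \<Rightarrow> nat \<Rightarrow> 'v set" where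
  "graph_ball V b a n = {x \<in> V. graph_dist V b a x < n}"

section \<open>Laplacian and capacity\<close>

text \<open>The sum over \<open>V\<close> is restricted to the neighbours of \<open>x\<close>, where the summands can be
  nonzero: this set is finite in a locally finite graph, whereas \<open>sum\<close> over an infinite set
  is 0 by convention.\<close>

definition laplacian ::
  "'v set \<Rightarrow> ('v \<Rightarrow> 'v \<Rightarrow> 'k::linordered_field) \<Rightarrow> ('v \<Rightarrow> 'k) \<Rightarrow> ('v \<Rightarrow> 'k) \<Rightarrow> 'v \<Rightarrow> 'k" where
  "laplacian V b m f x = 1 / m x * (\<Sum>y\<in>neighbours V b x. (f x - f y) * b x y)"

definition superharmonic ::
  "'v set \<Rightarrow> ('v \<Rightarrow> 'v \<Rightarrow> 'k::linordered_field) \<Rightarrow> ('v \<Rightarrow> 'k) \<Rightarrow> ('v \<Rightarrow> 'k) \<Rightarrow> bool" where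
  "superharmonic V b m u \<longleftrightarrow> (\<forall>x\<in>V. laplacian V b m u x \<ge> 0)"

definition harmonic ::
  "'v set \<Rightarrow> ('v \<Rightarrow> 'v \<Rightarrow> 'k::linordered_field) \<Rightarrow> ('v \<Rightarrow> 'k) \<Rightarrow> ('v \<Rightarrow> 'k) \<Rightarrow> bool" where
  "harmonic V b m u \<longleftrightarrow> (\<forall>x\<in>V. laplacian V b m u x = 0)"

text \<open>A positive function may vanish.\<close>

definition positive_on :: "'v set \<Rightarrow> ('v \<Rightarrow> 'k::linordered_field) \<Rightarrow> bool" where
  "positive_on V u \<longleftrightarrow> (\<forall>x\<in>V. u x \<ge> 0)"

text \<open>The unique function that is harmonic on \<open>K - {a}\<close>, equal to 1 at \<open>a\<close> and 0 on \<open>V - K\<close>,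
  for \<open>K \<subseteq> V\<close> finite and connected and \<open>a \<in> K\<close>. It is also required to be 0 outside \<open>V\<close>, so
  that it is unique as a total function.\<close>

definition equilibrium_potential ::
  "'v set \<Rightarrow> ('v \<Rightarrow> 'v \<Rightarrow> 'k::linordered_field) \<Rightarrow> ('v \<Rightarrow> 'k) \<Rightarrow> 'v set \<Rightarrow> 'v \<Rightarrow> 'v \<Rightarrow> 'k" where
  "equilibrium_potential V b m K a =
     (THE v. (\<forall>x\<in>K - {a}. laplacian V b m v x = 0) \<and> v a = 1 \<and> (\<forall>x. x \<notin> K \<longrightarrow> v x = 0))"

definition capacity ::
  "'v set \<Rightarrow> ('v \<Rightarrow> 'v \<Rightarrow> 'k::linordered_field) \<Rightarrow> ('v \<Rightarrow> 'k) \<Rightarrow> 'v set \<Rightarrow> 'v \<Rightarrow> 'k" where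
  "capacity V b m K a = laplacian V b m (equilibrium_potential V b m K a) a * m a"

text \<open>The ball of radius 0 is empty, so the term with index 0 is unspecified; it does not affect
  the limit.\<close>

definition null_capacity ::
  "'v set \<Rightarrow> ('v \<Rightarrow> 'v \<Rightarrow> 'k::linordered_field) \<Rightarrow> ('v \<Rightarrow> 'k) \<Rightarrow> bool" where
  "null_capacity V b m \<longleftrightarrow>
     (\<exists>a\<in>V. field_converges (\<lambda>n. capacity V b m (graph_ball V b a n) a) 0)"

end

theory Submission
  imports Defs
begin

text \<open>Let \<open>v\<^sub>n\<close> be the equilibrium potential of the ball of radius \<open>n\<close> about \<open>a\<close>.  For a positive
  superharmonic \<open>u\<close>, Green's formula gives \<open>m(x) \<Delta>u(x) v\<^sub>n(x) \<le> u(a) cap\<^sub>n(a)\<close> for every \<open>x\<close>, and a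
  Harnack inequality along a path from \<open>a\<close> to \<open>x\<close> bounds \<open>v\<^sub>n(x)\<close> below by a positive constant
  independent of \<open>n\<close>.  So \<open>cap\<^sub>n(a) \<rightarrow> 0\<close> forces \<open>\<Delta>u = 0\<close>.  If \<open>u\<close> is not constant, there is an edge
  \<open>x \<sim> y\<close> with \<open>u(x) < u(y)\<close>, and the truncation \<open>min u (u x)\<close> is positive and superharmonic, but not
  harmonic at \<open>x\<close>.\<close>

section \<open>Locally finite connected graphs and the unnormalised Laplacian\<close>

locale connected_graph =
  fixes V :: "'v set"
    and b :: "'v \<Rightarrow> 'v \<Rightarrow> 'k::linordered_field"
    and m :: "'v \<Rightarrow> 'k"
  assumes weighted: "weighted_graph V b m"
    and locally_finite: "graph_locally_finite V b"
    and connected: "graph_connected V b"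
begin

abbreviation N :: "'v \<Rightarrow> 'v set" where
  "N \<equiv> neighbours V b"

text \<open>The Laplacian multiplied by the vertex weight: it has the same sign and zeros on
  \<open>V\<close>, and Green's formula for it uses plain sums.\<close>

definition L :: "('v \<Rightarrow> 'k) \<Rightarrow> 'v \<Rightarrow> 'k" where
  "L f x = (\<Sum>y\<in>N x. (f x - f y) * b x y)"

lemma m_pos: "x \<in> V \<Longrightarrow> m x > 0"
  and b_nonneg: "x \<in> V \<Longrightarrow> y \<in> V \<Longrightarrow> b x y \<ge> 0"
  and b_sym: "x \<in> V \<Longrightarrow> y \<in> V \<Longrightarrow> b x y = b y x"
  using weighted by (auto simp: weighted_graph_def)

lemma finite_N: "x \<in> V \<Longrightarrow> finite (N x)"
  using locally_finite by (auto simp: graph_locally_finite_def)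

lemma N_in_V: "y \<in> N x \<Longrightarrow> y \<in> V"
  by (auto simp: neighbours_def)

lemma N_sym: "x \<in> V \<Longrightarrow> y \<in> N x \<Longrightarrow> x \<in> N y"
  using b_sym by (auto simp: neighbours_def)

lemma b_pos: "x \<in> V \<Longrightarrow> y \<in> N x \<Longrightarrow> b x y > 0"
  using b_nonneg[of x y] by (auto simp: neighbours_def order_less_le)

lemma laplacian_eq: "laplacian V b m f x = L f x / m x"
  by (simp add: laplacian_def L_def)

lemma laplacian_eq_0_iff: "x \<in> V \<Longrightarrow> laplacian V b m f x = 0 \<longleftrightarrow> L f x = 0"
  using m_pos[of x] by (simp add: laplacian_eq)

lemma laplacian_nonneg_iff: "x \<in> V \<Longrightarrow> laplacian V b m f x \<ge> 0 \<longleftrightarrow> L f x \<ge> 0"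
  using m_pos[of x] by (simp add: laplacian_eq zero_le_divide_iff)

lemma connected_induct [consumes 2, case_names base step]:
  assumes "a \<in> V" "x \<in> V" "P a"
    and step: "\<And>x y. x \<in> V \<Longrightarrow> y \<in> N x \<Longrightarrow> P x \<Longrightarrow> P y"
  shows "P x"
proof -
  have "(a, x) \<in> (edge_rel V b)\<^sup>*"
    using connected assms by (auto simp: graph_connected_def)
  then show ?thesis
    by (induction rule: rtrancl_induct) (use assms in \<open>auto simp: edge_rel_def\<close>)
qed

section \<open>Minimum principle and the finite Dirichlet problem\<close>

text \<open>A negative minimum is attained inside \<open>F\<close>. Superharmonicity there forces
  the same value at every neighbour, so by connectedness the minimum spreads to \<open>a\<close>,
  where \<open>f\<close> is nonnegative. The point \<open>a\<close> ensures that \<open>F\<close> is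
  not all of \<open>V\<close>.\<close>

lemma minimum_principle:
  assumes F: "finite F" "F \<subseteq> V" and a: "a \<in> V - F"
    and L: "\<And>x. x \<in> F \<Longrightarrow> L f x \<ge> 0"
    and off: "\<And>x. x \<in> V - F \<Longrightarrow> f x \<ge> 0"
    and x: "x \<in> V"
  shows "f x \<ge> 0"
proof (rule ccontr)
  assume neg: "\<not> f x \<ge> 0"
  with off x have "x \<in> F" by blast
  with F have fin: "finite (f ` F)" "f ` F \<noteq> {}" by auto
  define M where "M = Min (f ` F)"
  have M_le_F: "M \<le> f y" if "y \<in> F" for y
    using fin that by (simp add: M_def)
  have "M < 0"
    using M_le_F[OF \<open>x \<in> F\<close>] neg by simp
  have M_le: "M \<le> f y" if "y \<in> V" for y
    using M_le_F[of y] off[of y] \<open>M < 0\<close> that by force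
  obtain z where z: "z \<in> F" "f z = M"
    using Min_in[OF fin] by (auto simp: M_def)
  have "z \<in> V" using z F by blast
  have "f a = M" using \<open>z \<in> V\<close> _
  proof (induction rule: connected_induct)
    show "a \<in> V" using a by blast
    show "f z = M" by (fact z)
    fix w y assume w: "w \<in> V" "y \<in> N w" "f w = M"
    have "w \<in> F" using w off[of w] \<open>M < 0\<close> by force
    have nonpos: "(f w - f y') * b w y' \<le> 0" if "y' \<in> N w" for y'
      using M_le[OF N_in_V[OF that]] b_pos[OF w(1) that] w
      by (simp add: mult_le_0_iff)
    \<comment> \<open>At a minimum point no summand of \<open>L f w\<close> is positive, so all but
      the one for \<open>y\<close> may be dropped.\<close>
    have "L f w \<le> (f w - f y) * b w y"
      unfolding L_def sum.remove[OF finite_N[OF w(1)] w(2)]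
      using sum_nonpos[of "N w - {y}" "\<lambda>y'. (f w - f y') * b w y'"] nonpos by simp
    with L[OF \<open>w \<in> F\<close>] have "0 \<le> (f w - f y) * b w y" by linarith
    with b_pos[OF w(1,2)] have "f w \<ge> f y"
      by (simp add: zero_le_mult_iff)
    with M_le[OF N_in_V[OF w(2)]] w show "f y = M" by simp
  qed
  with off[OF a] \<open>M < 0\<close> show False by simp
qed

lemma L_add_scale: "L (\<lambda>y. f y + t * g y) x = L f x + t * L g x"
  unfolding L_def sum_distrib_left sum.distrib[symmetric]
  by (intro sum.cong) (auto simp: algebra_simps)

lemma dirichlet_unique_zero:
  assumes F: "finite F" "F \<subseteq> V" "a \<in> V - F"
    and L: "\<And>x. x \<in> F \<Longrightarrow> L f x = 0"
    and off: "\<And>x. x \<notin> F \<Longrightarrow> f x = 0"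
  shows "f x = 0"
proof (cases "x \<in> F")
  case True
  have "L (\<lambda>y. 0 + (- 1) * f y) y = 0" if "y \<in> F" for y
    unfolding L_add_scale using L[OF that] by (simp add: L_def)
  then have "- f x \<ge> 0"
    using minimum_principle[OF F, of "\<lambda>y. - f y" x] F True off by auto
  moreover have "f x \<ge> 0"
    using minimum_principle[OF F, of f x] F True L off by auto
  ultimately show ?thesis by simp
qed (simp add: off)

text \<open>Vertices are added to \<open>F\<close> one at a time. The solution \<open>h\<close> for
  the smaller set is corrected at the new vertex \<open>z\<close> by a multiple of \<open>e\<close>,
  which is harmonic on \<open>F\<close> with outer value 1 at \<open>z\<close> and 0
  elsewhere.\<close>

lemma dirichlet_exists:
  assumes "finite F" "F \<subseteq> V" "a \<in> V - F"
  shows "\<exists>f. (\<forall>x\<in>F. L f x = 0) \<and> (\<forall>x. x \<notin> F \<longrightarrow> f x = g x)"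
  using assms
proof (induction F arbitrary: g rule: finite_induct)
  case (insert z F)
  then have IH: "\<exists>f. (\<forall>x\<in>F. L f x = 0) \<and> (\<forall>x. x \<notin> F \<longrightarrow> f x = g x)" for g
    by auto
  obtain h where h: "\<And>x. x \<in> F \<Longrightarrow> L h x = 0" "\<And>x. x \<notin> F \<Longrightarrow> h x = g x"
    using IH[of g] by blast
  obtain e where e: "\<And>x. x \<in> F \<Longrightarrow> L e x = 0"
    "\<And>x. x \<notin> F \<Longrightarrow> e x = (if x = z then 1 else 0)"
    using IH[of "\<lambda>x. if x = z then 1 else 0"] by blast
  \<comment> \<open>Otherwise \<open>e\<close> would solve the homogeneous problem on
    \<open>insert z F\<close> and vanish, although it is 1 at \<open>z\<close>.\<close>
  have nz: "L e z \<noteq> 0"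
  proof
    assume "L e z = 0"
    have "e z = 0"
    proof (rule dirichlet_unique_zero)
      show "finite (insert z F)" using insert.hyps by simp
      show "insert z F \<subseteq> V" "a \<in> V - insert z F" by (fact insert.prems)+
      show "L e x = 0" if "x \<in> insert z F" for x
        using that e(1)[of x] \<open>L e z = 0\<close> by (cases "x = z") simp_all
      show "e x = 0" if "x \<notin> insert z F" for x
        using e(2)[of x] that by simp
    qed
    with e(2)[OF insert.hyps(2)] show False by simp
  qed
  \<comment> \<open>The coefficient is the one that makes \<open>L f z\<close> vanish.\<close>
  define f where "f = (\<lambda>y. h y + (- L h z / L e z) * e y)"
  have L_f: "L f x = L h x + (- L h z / L e z) * L e x" for x
    unfolding f_def L_add_scale ..
  have "L f x = 0" if "x \<in> insert z F" for x
    using that nz h e by (auto simp: L_f)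
  moreover have "f x = g x" if "x \<notin> insert z F" for x
    using that h e by (auto simp: f_def)
  ultimately show ?case by blast
qed auto

section \<open>Equilibrium potentials\<close>

text \<open>The definite description is justified by the Dirichlet problem on
  \<open>K - {a}\<close>, with \<open>a\<close> itself as the vertex outside.\<close>

lemma equilibrium_potential:
  assumes K: "finite K" "K \<subseteq> V" "a \<in> K"
  defines "v \<equiv> equilibrium_potential V b m K a"
  shows "\<And>x. x \<in> K - {a} \<Longrightarrow> L v x = 0" "v a = 1" "\<And>x. x \<notin> K \<Longrightarrow> v x = 0"
proof -
  let ?F = "K - {a}"
  let ?P = "\<lambda>v. (\<forall>x\<in>?F. laplacian V b m v x = 0) \<and> v a = 1 \<and> (\<forall>x. x \<notin> K \<longrightarrow> v x = 0)"
  have F: "finite ?F" "?F \<subseteq> V" "a \<in> V - ?F" using K by auto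
  have lap: "laplacian V b m f x = 0 \<longleftrightarrow> L f x = 0" if "x \<in> ?F" for f x
    using that K laplacian_eq_0_iff by blast
  obtain f where f: "\<And>x. x \<in> ?F \<Longrightarrow> L f x = 0"
    "\<And>x. x \<notin> ?F \<Longrightarrow> f x = (if x = a then 1 else 0)"
    using dirichlet_exists[OF F, of "\<lambda>x. if x = a then 1 else 0"] by blast
  have "?P f" using f K by (auto simp: lap)
  moreover have "g = f" if "?P g" for g
  proof
    fix x
    have "g x + (- 1) * f x = 0"
    proof (rule dirichlet_unique_zero[OF F])
      show "L (\<lambda>y. g y + (- 1) * f y) y = 0" if "y \<in> ?F" for y
        unfolding L_add_scale using f(1) \<open>?P g\<close> that lap by auto
      show "g y + (- 1) * f y = 0" if "y \<notin> ?F" for y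
        using f(2)[OF that] \<open>?P g\<close> that by auto
    qed
    then show "g x = f x" by simp
  qed
  ultimately have "?P v"
    unfolding v_def equilibrium_potential_def by (rule theI)
  then show "\<And>x. x \<in> K - {a} \<Longrightarrow> L v x = 0" "v a = 1" "\<And>x. x \<notin> K \<Longrightarrow> v x = 0"
    using lap by auto
qed

lemma equilibrium_potential_nonneg:
  assumes K: "finite K" "K \<subseteq> V" "a \<in> K"
  shows "equilibrium_potential V b m K a x \<ge> 0"
proof (cases "x \<in> K")
  case True
  note v = equilibrium_potential[OF K]
  show ?thesis
  proof (rule minimum_principle[of "K - {a}" a])
    fix y assume "y \<in> V - (K - {a})"
    then show "0 \<le> equilibrium_potential V b m K a y"
      by (cases "y = a") (auto simp: v)
  qed (use K True v(1) in auto)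
qed (use equilibrium_potential(3)[OF K] in simp)

lemma capacity_eq:
  "a \<in> V \<Longrightarrow> capacity V b m K a = L (equilibrium_potential V b m K a) a"
  using m_pos[of a] by (simp add: capacity_def laplacian_eq)

section \<open>Green's formula and the bound on capacity\<close>

lemma L_eq_sum:
  assumes "x \<in> V" "finite W" "N x \<subseteq> W" "W \<subseteq> V"
  shows "L f x = (\<Sum>y\<in>W. (f x - f y) * b x y)"
  unfolding L_def using assms
  by (intro sum.mono_neutral_left) (auto simp: neighbours_def)

text \<open>Over a common finite set \<open>W\<close> the two sums agree by symmetry of
  \<open>b\<close>. The terms from \<open>W - K\<close> survive only on the right, and they are
  nonpositive because \<open>v\<close> attains its minimum 0 there.\<close>

lemma green:
  assumes K: "finite K" "K \<subseteq> V" and v_off: "\<And>x. x \<notin> K \<Longrightarrow> v x = 0"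
    and v_nonneg: "\<And>x. v x \<ge> 0" and u_nonneg: "\<And>x. x \<in> V \<Longrightarrow> u x \<ge> 0"
  shows "(\<Sum>x\<in>K. L u x * v x) \<le> (\<Sum>x\<in>K. u x * L v x)"
proof -
  \<comment> \<open>\<open>K\<close> with its outer boundary: for \<open>x\<close> in
    \<open>K\<close>, summing over \<open>W\<close> gives the full \<open>L f x\<close>; for other
    \<open>x\<close> it sees only the neighbours in \<open>W\<close>.\<close>
  define W where "W = K \<union> (\<Union>x\<in>K. N x)"
  have W: "finite W" "W \<subseteq> V" "K \<subseteq> W" "\<And>x. x \<in> K \<Longrightarrow> N x \<subseteq> W"
    using K finite_N N_in_V by (auto simp: W_def)
  define S where "S f x = (\<Sum>y\<in>W. (f x - f y) * b x y)" for f x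
  have L_S: "L f x = S f x" if "x \<in> K" for f x
    unfolding S_def using that W K by (intro L_eq_sum) auto
  have "(\<Sum>x\<in>K. L u x * v x) = (\<Sum>x\<in>W. S u x * v x)"
    using W v_off L_S by (intro sum.mono_neutral_cong_left) auto
  also have "\<dots> = (\<Sum>x\<in>W. \<Sum>y\<in>W. u x * v x * b x y) - (\<Sum>x\<in>W. \<Sum>y\<in>W. u y * v x * b x y)"
    unfolding S_def sum_distrib_right sum_subtractf[symmetric]
    by (intro sum.cong refl) (simp add: algebra_simps)
  also have "(\<Sum>x\<in>W. \<Sum>y\<in>W. u y * v x * b x y) = (\<Sum>x\<in>W. \<Sum>y\<in>W. u x * v y * b x y)"
    by (subst sum.swap, intro sum.cong refl) (use W b_sym in \<open>metis subsetD\<close>)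
  also have "(\<Sum>x\<in>W. \<Sum>y\<in>W. u x * v x * b x y) - \<dots> = (\<Sum>x\<in>W. u x * S v x)"
    unfolding S_def sum_distrib_left sum_subtractf[symmetric]
    by (intro sum.cong refl) (simp add: algebra_simps)
  also have "\<dots> = (\<Sum>x\<in>W - K. u x * S v x) + (\<Sum>x\<in>K. u x * S v x)"
    using W by (intro sum.subset_diff) auto
  also have "(\<Sum>x\<in>W - K. u x * S v x) \<le> 0"
  proof (intro sum_nonpos)
    fix x assume x: "x \<in> W - K"
    then have "(v x - v y) * b x y \<le> 0" if "y \<in> W" for y
      using x v_off[of x] v_nonneg[of y] b_nonneg[of x y] W(2) that
      by (auto simp: subset_iff)
    then have "S v x \<le> 0"
      unfolding S_def by (intro sum_nonpos) auto
    with u_nonneg[of x] x W show "u x * S v x \<le> 0"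
      by (auto simp: mult_le_0_iff)
  qed
  finally show ?thesis by (simp add: L_S)
qed

text \<open>In Green's formula for the potential, the right side collapses to the term at
  \<open>a\<close>, and the left side has nonnegative terms, of which only the one at
  \<open>x\<close> is kept.\<close>

lemma capacity_lower_bound:
  assumes K: "finite K" "K \<subseteq> V" "a \<in> K"
    and u: "positive_on V u" "superharmonic V b m u" and x: "x \<in> K"
  shows "L u x * equilibrium_potential V b m K a x \<le> u a * capacity V b m K a"
proof -
  let ?v = "equilibrium_potential V b m K a"
  note v = equilibrium_potential[OF K] equilibrium_potential_nonneg[OF K]
  have "L u y * ?v y \<ge> 0" if "y \<in> K" for y
    using u(2) K that v(4) laplacian_nonneg_iff by (auto simp: superharmonic_def)
  then have "L u x * ?v x \<le> (\<Sum>y\<in>K. L u y * ?v y)"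
    using x K by (intro member_le_sum) auto
  also have "\<dots> \<le> (\<Sum>y\<in>K. u y * L ?v y)"
    using K u v by (intro green) (auto simp: positive_on_def)
  also have "\<dots> = u a * L ?v a"
    using K v(1) by (simp add: sum.remove[of K a])
  finally show ?thesis using K by (simp add: capacity_eq subset_iff)
qed

section \<open>Balls and the Harnack inequality\<close>

lemma graph_dist_path:
  assumes "a \<in> V" "x \<in> V"
  shows "(a, x) \<in> edge_rel V b ^^ graph_dist V b a x"
proof -
  have "\<exists>n. (a, x) \<in> edge_rel V b ^^ n"
    using connected assms by (auto simp: graph_connected_def rtrancl_power)
  then show ?thesis unfolding graph_dist_def by (rule LeastI_ex)
qed

text \<open>The ball is covered by the sets of vertices reached in exactly \<open>k < n\<close>
  steps, which are finite by local finiteness.\<close>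

lemma finite_graph_ball:
  assumes "a \<in> V"
  shows "finite (graph_ball V b a n)"
proof -
  have "(edge_rel V b ^^ k) `` {a} \<subseteq> V \<and> finite ((edge_rel V b ^^ k) `` {a})" for k
  proof (induction k)
    case (Suc k)
    have "(edge_rel V b ^^ Suc k) `` {a} = (\<Union>x\<in>(edge_rel V b ^^ k) `` {a}. N x)"
      using Suc by (auto simp: edge_rel_def)
    then show ?case using Suc finite_N N_in_V by auto
  qed (use assms in auto)
  then have "finite (\<Union>k<n. (edge_rel V b ^^ k) `` {a})" by blast
  then show ?thesis
    by (rule finite_subset[rotated]) (use graph_dist_path[OF assms] in \<open>auto simp: graph_ball_def\<close>)
qed

lemma center_in_graph_ball: "a \<in> V \<Longrightarrow> n \<ge> 1 \<Longrightarrow> a \<in> graph_ball V b a n"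
  using Least_le[of "\<lambda>n. (a, a) \<in> edge_rel V b ^^ n" 0]
  by (simp add: graph_ball_def graph_dist_def)

text \<open>Harmonicity at \<open>y\<close> makes \<open>v y\<close> a weighted mean of its
  neighbouring values; by nonnegativity all but the one at \<open>x\<close> may be dropped. The
  factor does not depend on \<open>K\<close>.\<close>

lemma harnack:
  assumes K: "finite K" "K \<subseteq> V" "a \<in> K" and xy: "x \<in> V" "y \<in> N x" "y \<in> K" "y \<noteq> a"
  defines "v \<equiv> equilibrium_potential V b m K a"
  shows "v x * (b y x / (\<Sum>z\<in>N y. b y z)) \<le> v y" "(\<Sum>z\<in>N y. b y z) > 0"
proof -
  have y: "y \<in> V" "x \<in> N y" using xy(1,2) by (blast intro: N_in_V N_sym)+
  let ?D = "\<Sum>z\<in>N y. b y z"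
  have "L v y = v y * ?D - (\<Sum>z\<in>N y. v z * b y z)"
    unfolding L_def sum_distrib_left sum_subtractf[symmetric]
    by (intro sum.cong refl) (simp add: algebra_simps)
  with equilibrium_potential(1)[OF K, of y] xy
  have "(\<Sum>z\<in>N y. v z * b y z) = v y * ?D" by (simp add: v_def)
  moreover have "v x * b y x \<le> (\<Sum>z\<in>N y. v z * b y z)"
    using y finite_N b_pos[OF y(1)] equilibrium_potential_nonneg[OF K]
    by (intro member_le_sum) (auto simp: v_def less_imp_le)
  ultimately have "v x * b y x \<le> v y * ?D" by simp
  moreover show "?D > 0"
    using y finite_N b_pos[OF y(1)] by (intro sum_pos) auto
  ultimately show "v x * (b y x / ?D) \<le> v y" by (simp add: field_simps)
qed

text \<open>The Harnack factors are multiplied along a path from \<open>a\<close>, starting from the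
  value 1 at \<open>a\<close>. The constant is uniform in \<open>n\<close>.\<close>

lemma equilibrium_potential_lower_bound:
  assumes a: "a \<in> V" and x: "x \<in> V"
  shows "\<exists>c>0. \<exists>n\<^sub>0. \<forall>n\<ge>n\<^sub>0. c \<le> equilibrium_potential V b m (graph_ball V b a n) a x"
  using a x
proof (induction rule: connected_induct)
  case base
  \<comment> \<open>The ball of radius 0 is empty, so its potential is unspecified.\<close>
  have "\<forall>n\<ge>1. 1 \<le> equilibrium_potential V b m (graph_ball V b a n) a a"
    using equilibrium_potential(2)[OF finite_graph_ball[OF a] _ center_in_graph_ball[OF a]]
    by (auto simp: graph_ball_def)
  then show ?case using zero_less_one by blast
next
  case (step x y)
  let ?v = "\<lambda>n. equilibrium_potential V b m (graph_ball V b a n) a"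
  have ball: "finite (graph_ball V b a n)" "graph_ball V b a n \<subseteq> V" for n
    using finite_graph_ball[OF a] by (auto simp: graph_ball_def)
  obtain c n0 where c: "c > 0" "\<And>n. n \<ge> n0 \<Longrightarrow> c \<le> ?v n x"
    using step by blast
  have y: "y \<in> V" "x \<in> N y" using step(1,2) by (blast intro: N_in_V N_sym)+
  show ?case
  \<comment> \<open>The path may return to \<open>a\<close>, where the potential need not be
    harmonic but is known to be 1.\<close>
  proof (cases "y = a")
    case True
    have "\<forall>n\<ge>1. 1 \<le> ?v n y"
      using equilibrium_potential(2)[OF ball center_in_graph_ball[OF a]] True by auto
    then show ?thesis using zero_less_one by blast
  next
    case False
    define q where "q = b y x / (\<Sum>z\<in>N y. b y z)"
    define n1 where "n1 = Suc (n0 + graph_dist V b a y)"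
    have in_ball: "y \<in> graph_ball V b a n" "a \<in> graph_ball V b a n" if "n \<ge> n1" for n
      using that y center_in_graph_ball[OF a, of n] by (auto simp: n1_def graph_ball_def)
    note H = harnack[OF ball in_ball(2) step(1,2) in_ball(1) False, folded q_def]
    have "q > 0"
      using b_pos[OF y] H(2)[of n1] by (simp add: q_def)
    have "c * q \<le> ?v n y" if "n \<ge> n1" for n
    proof -
      have "c * q \<le> ?v n x * q"
        using c(2)[of n] that \<open>q > 0\<close> by (simp add: n1_def)
      also have "\<dots> \<le> ?v n y" using H(1) that by blast
      finally show ?thesis .
    qed
    then show ?thesis using c(1) \<open>q > 0\<close> by (intro exI[of _ "c * q"]) auto
  qed
qed

section \<open>Superharmonic functions and null capacity\<close>

theorem not_null_capacity_if_not_harmonic: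
  assumes u: "positive_on V u" "superharmonic V b m u" "\<not> harmonic V b m u"
  shows "\<not> null_capacity V b m"
proof
  assume "null_capacity V b m"
  then obtain a where a: "a \<in> V"
    and lim: "field_converges (\<lambda>n. capacity V b m (graph_ball V b a n) a) 0"
    by (auto simp: null_capacity_def)
  obtain x where x: "x \<in> V" "L u x > 0"
    using u laplacian_nonneg_iff laplacian_eq_0_iff
    by (force simp: harmonic_def superharmonic_def order_less_le)
  obtain c n0 where c: "c > 0"
    "\<And>n. n \<ge> n0 \<Longrightarrow> c \<le> equilibrium_potential V b m (graph_ball V b a n) a x"
    using equilibrium_potential_lower_bound[OF a x(1)] by blast
  have ua: "u a \<ge> 0" using u a by (auto simp: positive_on_def)
  \<comment> \<open>Chosen so that \<open>(u a + 1) * d = L u x * c\<close>. The added 1 covers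
    \<open>u a = 0\<close> and makes the final estimate strict.\<close>
  define d where "d = L u x * c / (u a + 1)"
  have "d > 0" using x c ua by (simp add: d_def)
  then obtain n1 where n1: "\<And>n. n \<ge> n1 \<Longrightarrow> \<bar>capacity V b m (graph_ball V b a n) a\<bar> \<le> d"
    using lim by (auto simp: field_converges_def)
  define n where "n = Suc (n0 + n1 + graph_dist V b a x)"
  let ?B = "graph_ball V b a n"
  have B: "finite ?B" "?B \<subseteq> V" "a \<in> ?B" "x \<in> ?B"
    using finite_graph_ball[OF a] center_in_graph_ball[OF a] x
    by (auto simp: graph_ball_def n_def)
  have "L u x * c \<le> L u x * equilibrium_potential V b m ?B a x"
    using c x by (simp add: n_def)
  also have "\<dots> \<le> u a * capacity V b m ?B a"
    by (rule capacity_lower_bound[OF B(1-3) u(1,2) B(4)])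
  also have "\<dots> \<le> u a * d"
    using n1[of n] ua by (intro mult_left_mono) (auto simp: n_def)
  also have "\<dots> < (u a + 1) * d" using \<open>d > 0\<close> by simp
  also have "\<dots> = L u x * c" using ua by (simp add: d_def)
  finally show False by simp
qed

text \<open>Where \<open>u x \<le> c\<close>, truncation keeps the value at \<open>x\<close> and can
  only lower the neighbours; elsewhere the truncated function has its maximum \<open>c\<close> at
  \<open>x\<close>.\<close>

lemma superharmonic_min:
  assumes "superharmonic V b m u"
  shows "superharmonic V b m (\<lambda>x. min (u x) c)"
  unfolding superharmonic_def
proof
  fix x assume x: "x \<in> V"
  have "L (\<lambda>x. min (u x) c) x \<ge> 0"
  proof (cases "u x \<le> c")
    case True
    have "0 \<le> L u x"
      using assms x laplacian_nonneg_iff by (auto simp: superharmonic_def)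
    also have "\<dots> \<le> L (\<lambda>x. min (u x) c) x"
      unfolding L_def using b_pos[OF x] True
      by (intro sum_mono mult_right_mono) (auto simp: less_imp_le)
    finally show ?thesis .
  next
    case False
    then show ?thesis
      unfolding L_def using b_pos[OF x]
      by (intro sum_nonneg mult_nonneg_nonneg) (auto simp: less_imp_le)
  qed
  then show "laplacian V b m (\<lambda>x. min (u x) c) x \<ge> 0"
    using x laplacian_nonneg_iff by blast
qed

text \<open>If \<open>u\<close> increased along no edge, reversing edges would make it equal across
  each edge, hence constant by connectedness.\<close>

lemma nonconstant_edge:
  fixes u :: "'v \<Rightarrow> 'k"
  assumes nonconst: "\<not> (\<exists>c. \<forall>x\<in>V. u x = c)"
  obtains (edge) x y where "x \<in> V" "y \<in> N x" "u x < u y"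
proof (rule ccontr)
  assume neg: "\<not> thesis"
  have le: "u y \<le> u x" if "x \<in> V" "y \<in> N x" for x y
  proof (rule ccontr)
    assume "\<not> u y \<le> u x"
    with edge[OF that] neg show False by simp
  qed
  have eq: "u y = u x" if "x \<in> V" "y \<in> N x" for x y
    using le[OF that] le[of y x] N_sym[OF that] N_in_V[OF that(2)] by simp
  have "u x = u a" if "a \<in> V" "x \<in> V" for a x
    using that by (induction rule: connected_induct) (auto simp: eq)
  with nonconst show False by blast
qed

text \<open>Truncation at level \<open>u x\<close> keeps the value at \<open>x\<close> and strictly
  lowers the one at \<open>y\<close>, which pushes \<open>L\<close> at \<open>x\<close> strictly
  above \<open>L u x \<ge> 0\<close>.\<close>

lemma not_harmonic_min:
  assumes u: "superharmonic V b m u" and x: "x \<in> V" "y \<in> N x" "u x < u y"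
  shows "\<not> harmonic V b m (\<lambda>z. min (u z) (u x))"
proof
  let ?w = "\<lambda>z. min (u z) (u x)"
  assume "harmonic V b m ?w"
  then have "L ?w x = 0"
    using x laplacian_eq_0_iff by (auto simp: harmonic_def)
  have "0 \<le> L u x"
    using u x laplacian_nonneg_iff by (auto simp: superharmonic_def)
  also have "L u x < L ?w x"
    unfolding L_def
  proof (rule sum_strict_mono_ex1)
    show "\<forall>z\<in>N x. (u x - u z) * b x z \<le> (?w x - ?w z) * b x z"
      using b_pos[OF x(1)] by (auto intro!: mult_right_mono simp: less_imp_le)
    show "\<exists>z\<in>N x. (u x - u z) * b x z < (?w x - ?w z) * b x z"
      using b_pos[OF x(1,2)] x
      by (intro bexI[of _ y]) (auto simp: mult_less_0_iff)
  qed (use finite_N x in auto)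
  finally show False using \<open>L ?w x = 0\<close> by simp
qed

theorem not_null_capacity_if_not_constant:
  assumes u: "positive_on V u" "superharmonic V b m u" "\<not> (\<exists>c. \<forall>x\<in>V. u x = c)"
  shows "\<not> null_capacity V b m"
proof -
  obtain x y where xy: "x \<in> V" "y \<in> N x" "u x < u y"
    using nonconstant_edge[OF u(3)] .
  have "positive_on V (\<lambda>z. min (u z) (u x))"
    using u(1) xy by (auto simp: positive_on_def)
  then show ?thesis
    using superharmonic_min[OF u(2)] not_harmonic_min[OF u(2) xy]
    by (rule not_null_capacity_if_not_harmonic)
qed

end

theorem theorem7p4:
  fixes V :: "'v set"
    and b :: "'v \<Rightarrow> 'v \<Rightarrow> 'k::linordered_field"
    and m :: "'v \<Rightarrow> 'k"
  assumes "non_archimedean TYPE('k)"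
    and "Cauchy_complete TYPE('k)"
    and "countable_cofinality TYPE('k)"
    and "weighted_graph V b m"
    and "infinite V"
    and "graph_locally_finite V b"
    and "graph_connected V b"
  shows "((\<exists>u. positive_on V u \<and> superharmonic V b m u \<and> \<not> harmonic V b m u)
            \<longrightarrow> \<not> null_capacity V b m) \<and>
         (real_closed TYPE('k) \<longrightarrow>
            (\<exists>u. positive_on V u \<and> superharmonic V b m u \<and> \<not> (\<exists>c. \<forall>x\<in>V. u x = c))
            \<longrightarrow> \<not> null_capacity V b m)"
proof -
  interpret connected_graph V b m
    using assms(4,6,7) by (rule connected_graph.intro)
  show ?thesis
  proof (intro conjI impI; elim exE conjE)
    fix u
    assume "positive_on V u" "superharmonic V b m u" "\<not> harmonic V b m u"
    then show "\<not> null_capacity V b m" by (rule not_null_capacity_if_not_harmonic)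
  next
    fix u
    assume "positive_on V u" "superharmonic V b m u" "\<not> (\<exists>c. \<forall>x\<in>V. u x = c)"
    then show "\<not> null_capacity V b m" by (rule not_null_capacity_if_not_constant)
  qed
qed

end
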